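(* Let $X$ be a synchronized system with Fischer cover $\mathcal G=(G,\mathcal L)$. Then the cover map $\mathcal L_\infty: X_G\to X$ is irreducible.
   Context: A shift space $X$ over a finite alphabet $\mathcal A$ is a closed shift-invariant subset of $\mathcal A^{\mathbb Z}$; $\mathcal B(X)$ is its language. $X$ is irreducible if for all $u,v\in\mathcal B(X)$ there is $w$ with $uwv\in\mathcal B(X)$. A word $v\in\mathcal B(X)$ is synchronizing if $uv,vw\in\mathcal B(X)$ implies $uvw\in\mathcal B(X)$; an irreducible shift space with a synchronizing word is a synchronized system. Fischer cover: for $x\in X$ write $x_-=(x_i)_{i<0}$ (a left infinite $X$-ray) and $x_+=(x_i)_{i\ge 0}$ (a right infinite $X$-ray). The follower set of $x_-$ is $\omega_+(x_-)=\{x_+ : x_-x_+ \text{ is a point of } X\}$, the set of right infinite rays that can follow $x_-$. The Krieger graph of $X$ is the labeled graph whose vertices are all the follower sets $\omega_+(x_-)$, with an edge labeled $a$ from $I_1$ to $I_2$ if and only if there is a left $X$-ray $x_-$ such that $x_-a$ is a left $X$-ray, $I_1=\omega_+(x_-)$ and $I_2=\omega_+(x_-a)$. If $\alpha$ is a synchronizing word of $X$, all left rays ending in $\alpha$ have the same follower set, denoted $\omega_+(\alpha)$. The (right) Fischer cover $\mathcal G=(G,\mathcal L)$ of $X$ is the irreducible component (maximal strongly connected subgraph) of the Krieger graph containing the vertex $\omega_+(\alpha)$; $\mathcal L$ is its edge labeling. $X_G$ is the edge shift of $G$: the set of bi-infinite sequences of edges of $G$ forming bi-infinite paths, with the topology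 induced by the product of discrete topologies. $\mathcal L_\infty$ applies $\mathcal L$ coordinatewise. A map $\phi:X\to Y$ is irreducible if the only closed set $A\subseteq X$ with $\phi(A)=\phi(X)$ is $A=X$. *)

theory Defs
  imports "HOL-Analysis.Function_Topology" "Graph_Theory.Digraph_Component"
begin

section \<open>Shift spaces\<close>

definition sequence_topology :: "'b set \<Rightarrow> (int \<Rightarrow> 'b) topology" where
  "sequence_topology S = product_topology (\<lambda>_. discrete_topology S) UNIV"

definition shift_map :: "(int \<Rightarrow> 'b) \<Rightarrow> int \<Rightarrow> 'b" where
  "shift_map x = (\<lambda>i. x (i + 1))"

definition shift_space :: "'a set \<Rightarrow> (int \<Rightarrow> 'a) set \<Rightarrow> bool" where
  "shift_space A X \<longleftrightarrow> finite A \<and> closedin (sequence_topology A) X \<and> shift_map ` X = X"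

definition language :: "(int \<Rightarrow> 'a) set \<Rightarrow> 'a list set" where
  "language X = {w. \<exists>x\<in>X. \<exists>i::int. w = map (\<lambda>k. x (i + int k)) [0..<length w]}"

definition irreducible_shift :: "(int \<Rightarrow> 'a) set \<Rightarrow> bool" where
  "irreducible_shift X \<longleftrightarrow>
     (\<forall>u\<in>language X. \<forall>v\<in>language X. \<exists>w. u @ w @ v \<in> language X)"

definition synchronizing :: "(int \<Rightarrow> 'a) set \<Rightarrow> 'a list \<Rightarrow> bool" where
  "synchronizing X v \<longleftrightarrow> v \<in> language X \<and>
     (\<forall>u w. u @ v \<in> language X \<longrightarrow> v @ w \<in> language X \<longrightarrow> u @ v @ w \<in> language X)"

definition synchronized_system :: "'a set \<Rightarrow> (int \<Rightarrow> 'a) set \<Rightarrow> bool" where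
  "synchronized_system A X \<longleftrightarrow>
     shift_space A X \<and> irreducible_shift X \<and> (\<exists>v. synchronizing X v)"

section \<open>Rays and follower sets\<close>

text \<open>A left infinite ray is stored as a function on the naturals, read from right to left:
  index \<open>n\<close> holds the letter at position \<open>- n - 1\<close>. A right infinite ray holds at index
  \<open>n\<close> the letter at position \<open>n\<close>.\<close>

definition left_part :: "(int \<Rightarrow> 'a) \<Rightarrow> nat \<Rightarrow> 'a" where
  "left_part x = (\<lambda>n. x (- int n - 1))"

definition join_rays :: "(nat \<Rightarrow> 'a) \<Rightarrow> (nat \<Rightarrow> 'a) \<Rightarrow> int \<Rightarrow> 'a" where
  "join_rays l r = (\<lambda>i. if i < 0 then l (nat (- i - 1)) else r (nat i))"

definition left_rays :: "(int \<Rightarrow> 'a) set \<Rightarrow> (nat \<Rightarrow> 'a) set" where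
  "left_rays X = left_part ` X"

definition append_letter :: "(nat \<Rightarrow> 'a) \<Rightarrow> 'a \<Rightarrow> nat \<Rightarrow> 'a" where
  "append_letter l a = case_nat a l"

definition ends_in :: "(nat \<Rightarrow> 'a) \<Rightarrow> 'a list \<Rightarrow> bool" where
  "ends_in l v \<longleftrightarrow> map l [0..<length v] = rev v"

definition follower_set :: "(int \<Rightarrow> 'a) set \<Rightarrow> (nat \<Rightarrow> 'a) \<Rightarrow> (nat \<Rightarrow> 'a) set" where
  "follower_set X l = {r. join_rays l r \<in> X}"

text \<open>Meaningful only when \<open>v\<close> is synchronizing: then the image below is a singleton.\<close>

definition word_follower_set :: "(int \<Rightarrow> 'a) set \<Rightarrow> 'a list \<Rightarrow> (nat \<Rightarrow> 'a) set" where
  "word_follower_set X v = the_elem (follower_set X ` {l \<in> left_rays X. ends_in l v})"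

section \<open>The Krieger graph and the Fischer cover\<close>

text \<open>An edge from \<open>I\<close> to \<open>J\<close> labeled \<open>a\<close> is the triple \<open>(I, a, J)\<close>.\<close>

type_synonym 'a edge = "(nat \<Rightarrow> 'a) set \<times> 'a \<times> (nat \<Rightarrow> 'a) set"

definition edge_label :: "'a edge \<Rightarrow> 'a" where
  "edge_label e = fst (snd e)"

definition krieger_graph :: "(int \<Rightarrow> 'a) set \<Rightarrow> ((nat \<Rightarrow> 'a) set, 'a edge) pre_digraph" where
  "krieger_graph X =
     \<lparr>verts = follower_set X ` left_rays X,
      arcs = {(I, a, J). \<exists>l. l \<in> left_rays X \<and> append_letter l a \<in> left_rays X \<and>
                I = follower_set X l \<and> J = follower_set X (append_letter l a)},
      tail = (\<lambda>e. fst e),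
      head = (\<lambda>e. snd (snd e))\<rparr>"

definition is_fischer_cover ::
    "(int \<Rightarrow> 'a) set \<Rightarrow> ((nat \<Rightarrow> 'a) set, 'a edge) pre_digraph \<Rightarrow> bool" where
  "is_fischer_cover X G \<longleftrightarrow> G \<in> pre_digraph.sccs (krieger_graph X) \<and>
     (\<exists>v. synchronizing X v \<and> word_follower_set X v \<in> verts G)"

section \<open>Edge shifts and irreducible maps\<close>

definition edge_shift :: "('v, 'e) pre_digraph \<Rightarrow> (int \<Rightarrow> 'e) set" where
  "edge_shift G = {p. \<forall>i. p i \<in> arcs G \<and> head G (p i) = tail G (p (i + 1))}"

definition edge_shift_topology :: "('v, 'e) pre_digraph \<Rightarrow> (int \<Rightarrow> 'e) topology" where
  "edge_shift_topology G = subtopology (sequence_topology (arcs G)) (edge_shift G)"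

definition cover_map :: "(int \<Rightarrow> 'a edge) \<Rightarrow> int \<Rightarrow> 'a" where
  "cover_map p = (\<lambda>i. edge_label (p i))"

text \<open>A map between topological spaces is understood to be continuous and to land in the
  codomain; surjectivity is not required.\<close>

definition irreducible_map :: "'b topology \<Rightarrow> 'c topology \<Rightarrow> ('b \<Rightarrow> 'c) \<Rightarrow> bool" where
  "irreducible_map S T f \<longleftrightarrow> continuous_map S T f \<and>
     (\<forall>C. closedin S C \<and> f ` C = f ` topspace S \<longrightarrow> C = topspace S)"

end

theory Submission
  imports Defs
begin

text \<open>
  The Krieger graph is deterministic: the head of an edge labeled \<open>a\<close> that leaves the vertex
  \<open>I\<close> is the set of all rays \<open>r\<close> with \<open>a r \<in> I\<close>. Consequently every path labeled by a
  synchronizing word \<open>v\<close> ends at the vertex \<open>\<omega>\<^sub>+(v)\<close>, and from there on its labels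
  determine its edges (\<open>krieger_path_synchronizing\<close>, \<open>krieger_arc_eqI\<close>).

  The theorem follows by inserting such a word into the past of a given point \<open>p\<close> of the edge
  shift of the Fischer cover \<open>G\<close>. Since \<open>X\<close> is irreducible, \<open>v u v\<close> is a word of \<open>X\<close> for some
  \<open>u\<close>; it traces out a cycle labeled \<open>u v\<close> from \<open>\<omega>\<^sub>+(v)\<close> to itself, and this cycle lies in
  \<open>G\<close> because \<open>G\<close> is a maximal strongly connected subgraph. Given an integer \<open>N\<close>, follow \<open>p\<close>
  up to its vertex at position \<open>N\<close>, walk inside \<open>G\<close> to \<open>\<omega>\<^sub>+(v)\<close>, go around the cycle, walk back,
  and continue along \<open>p\<close>. The inserted closed walk is placed so that the resulting point \<open>q\<close>
  agrees with \<open>p\<close> from \<open>N\<close> on. Every point \<open>q'\<close> of the edge shift with the same labels as \<open>q\<close>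
  is synchronized by \<open>v\<close> before \<open>N\<close>, so it also agrees with \<open>p\<close> from \<open>N\<close> on
  (\<open>fischer_cover_forced_future\<close>).

  If \<open>C\<close> is closed and has the same image as the whole edge shift, then \<open>C\<close> contains such a
  \<open>q'\<close> for every \<open>N\<close>. Letting \<open>N\<close> tend to \<open>-\<infinity>\<close> exhibits \<open>p\<close> as a limit of points of \<open>C\<close>.

  Continuity is a matter of single coordinates. That the cover map has values in \<open>X\<close> holds because
  every finite stretch of labels along a path occurs in a point of \<open>X\<close>, and \<open>X\<close> is closed
  (\<open>cover_map_in_shift\<close>).
\<close>

section \<open>Shift spaces and their languages\<close>

lemma shift_space_shift:
  assumes "shift_space A X" "x \<in> X"
  shows "(\<lambda>i. x (i + j)) \<in> X"
proof -
  have up: "shift_map y \<in> X" if "y \<in> X" for y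
    using assms(1) that by (auto simp: shift_space_def)
  have down: "(\<lambda>i. y (i - 1)) \<in> X" if "y \<in> X" for y
  proof -
    from that assms(1) obtain z where "z \<in> X" "y = shift_map z"
      by (auto simp: shift_space_def)
    then show ?thesis by (simp add: shift_map_def)
  qed
  show ?thesis
  proof (induction j rule: int_induct[where k = 0])
    case base
    then show ?case using assms(2) by simp
  next
    case (step1 j)
    then show ?case using up[of "\<lambda>i. x (i + j)"] by (simp add: shift_map_def algebra_simps)
  next
    case (step2 j)
    then show ?case using down[of "\<lambda>i. x (i + j)"] by (simp add: algebra_simps)
  qed
qed

lemma shift_space_shift_iff:
  assumes "shift_space A X"
  shows "(\<lambda>i. x (i + j)) \<in> X \<longleftrightarrow> x \<in> X"
  using shift_space_shift[OF assms, of x j] shift_space_shift[OF assms, of "\<lambda>i. x (i + j)" "- j"]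
  by auto

text \<open>Only discreteness of the factors matters here: \<open>S\<close> may be infinite, as the set of edges of
  a Fischer cover can be.\<close>

lemma closed_under_local_approximation:
  fixes x :: "int \<Rightarrow> 'b"
  assumes closed: "closedin (sequence_topology S) C"
    and approx: "\<And>n::nat. \<exists>y\<in>C. \<forall>i. \<bar>i\<bar> \<le> int n \<longrightarrow> y i = x i"
  shows "x \<in> C"
proof (rule ccontr)
  assume "x \<notin> C"
  have sub: "C \<subseteq> (UNIV \<rightarrow>\<^sub>E S)"
    using closedin_subset[OF closed] by (simp add: sequence_topology_def)
  have "x i \<in> S" for i
  proof -
    obtain y where "y \<in> C" "y i = x i" using approx[of "nat \<bar>i\<bar>"] by auto
    then show ?thesis using sub by (metis PiE_mem UNIV_I subsetD)
  qed
  then have x_compl: "x \<in> topspace (sequence_topology S) - C"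
    using \<open>x \<notin> C\<close> by (auto simp: sequence_topology_def)
  have "openin (sequence_topology S) (topspace (sequence_topology S) - C)"
    using closed by blast
  then have "\<forall>z\<in>topspace (sequence_topology S) - C. \<exists>U. finite {i. U i \<noteq> S} \<and>
      (\<forall>i. U i \<subseteq> S) \<and> z \<in> Pi\<^sub>E UNIV U \<and> Pi\<^sub>E UNIV U \<subseteq> topspace (sequence_topology S) - C"
    unfolding sequence_topology_def openin_product_topology_alt by simp
  from bspec[OF this x_compl]
  obtain U where fin: "finite {i. U i \<noteq> S}" and x: "x \<in> Pi\<^sub>E UNIV U"
    and disj: "Pi\<^sub>E UNIV U \<subseteq> topspace (sequence_topology S) - C"
    by blast
  have "finite ((\<lambda>i. nat \<bar>i\<bar>) ` {i. U i \<noteq> S})" using fin by simp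
  then obtain n where n: "\<And>i. U i \<noteq> S \<Longrightarrow> nat \<bar>i\<bar> \<le> n"
    unfolding finite_nat_set_iff_bounded_le by blast
  obtain y where y: "y \<in> C" "\<And>i. \<bar>i\<bar> \<le> int n \<Longrightarrow> y i = x i" using approx[of n] by blast
  have "y i \<in> U i" for i
  proof (cases "U i = S")
    case True
    then show ?thesis using sub y(1) by auto
  next
    case False
    then have "y i = x i" using n[of i] y(2)[of i] by linarith
    then show ?thesis using x by auto
  qed
  then have "y \<in> (Pi\<^sub>E UNIV U)" by auto
  with disj y(1) show False by blast
qed

text \<open>The word of length \<open>m\<close> that \<open>x\<close> carries from position \<open>i\<close> on.\<close>

definition word_at :: "(int \<Rightarrow> 'a) \<Rightarrow> int \<Rightarrow> nat \<Rightarrow> 'a list" where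
  "word_at x i m = map (\<lambda>k. x (i + int k)) [0..<m]"

lemma length_word_at [simp]: "length (word_at x i m) = m"
  by (simp add: word_at_def)

lemma nth_word_at [simp]: "k < m \<Longrightarrow> word_at x i m ! k = x (i + int k)"
  by (simp add: word_at_def)

lemma word_at_append: "word_at x i m @ word_at x (i + int m) n = word_at x i (m + n)"
  by (rule nth_equalityI) (auto simp: nth_append)

lemma word_at_cong: "(\<And>k. i \<le> k \<Longrightarrow> k < i + int m \<Longrightarrow> x k = y k) \<Longrightarrow> word_at x i m = word_at y i m"
  by (simp add: word_at_def)

lemma word_at_shift: "word_at (\<lambda>k. x (k + j)) i m = word_at x (i + j) m"
  by (simp add: word_at_def algebra_simps)

lemma word_at_in_language: "x \<in> X \<Longrightarrow> word_at x i m \<in> language X"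
  unfolding language_def word_at_def by auto

lemma language_word_atE:
  assumes "shift_space A X" "w \<in> language X"
  obtains x where "x \<in> X" "word_at x i (length w) = w"
proof -
  obtain y j where y: "y \<in> X" "w = word_at y j (length w)"
    using assms(2) unfolding language_def word_at_def by auto
  show ?thesis
  proof
    show "(\<lambda>k. y (k + (j - i))) \<in> X" using assms(1) y(1) by (rule shift_space_shift)
    show "word_at (\<lambda>k. y (k + (j - i))) i (length w) = w"
      using y(2) by (simp add: word_at_shift)
  qed
qed

section \<open>Follower sets\<close>

lemma join_left_part: "join_rays (left_part x) (\<lambda>n. x (int n)) = x"
  by (auto simp: join_rays_def left_part_def)

lemma left_part_join [simp]: "left_part (join_rays l r) = l"
  by (auto simp: join_rays_def left_part_def)

lemma left_rays_iff: "l \<in> left_rays X \<longleftrightarrow> follower_set X l \<noteq> {}"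
proof
  assume "l \<in> left_rays X"
  then obtain x where "x \<in> X" "l = left_part x" by (auto simp: left_rays_def)
  then have "(\<lambda>n. x (int n)) \<in> follower_set X l" by (simp add: follower_set_def join_left_part)
  then show "follower_set X l \<noteq> {}" by auto
next
  assume "follower_set X l \<noteq> {}"
  then obtain r where "join_rays l r \<in> X" by (auto simp: follower_set_def)
  then show "l \<in> left_rays X" unfolding left_rays_def by (metis image_eqI left_part_join)
qed

lemma ends_in_iff: "ends_in l v \<longleftrightarrow> word_at (join_rays l r) (- int (length v)) (length v) = v"
proof -
  have "map l [0..<length v] = rev (word_at (join_rays l r) (- int (length v)) (length v))"
    by (rule nth_equalityI) (auto simp: rev_nth join_rays_def nat_diff_distrib' of_nat_diff)
  then show ?thesis unfolding ends_in_def by (metis rev_is_rev_conv rev_rev_ident)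
qed

lemma follower_set_append_letter:
  assumes "shift_space A X"
  shows "follower_set X (append_letter l a) = {r. case_nat a r \<in> follower_set X l}"
proof -
  have eq: "join_rays (append_letter l a) r = (\<lambda>i. join_rays l (case_nat a r) (i + 1))" for r
  proof
    fix i :: int
    consider "i \<ge> 0" | "i = - 1" | "i < - 1" by linarith
    then show "join_rays (append_letter l a) r i = join_rays l (case_nat a r) (i + 1)"
    proof cases
      case 1
      then have "nat (i + 1) = Suc (nat i)" by linarith
      with 1 show ?thesis by (simp add: join_rays_def)
    next
      case 2
      then show ?thesis by (simp add: join_rays_def append_letter_def)
    next
      case 3
      then have "nat (- i - 1) = Suc (nat (- (i + 1) - 1))" by linarith
      with 3 show ?thesis by (simp add: join_rays_def append_letter_def)
    qed
  qed
  show ?thesis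
    unfolding follower_set_def eq mem_Collect_eq shift_space_shift_iff[OF assms] ..
qed

text \<open>The follower set of a left ray ending in a synchronizing word does not depend on the ray;
  by symmetry an inclusion is enough. The synchronizing property concerns finite words only, and
  closedness of \<open>X\<close> carries it over to rays.\<close>

lemma synchronizing_follower_set_mono:
  assumes X: "shift_space A X" and v: "synchronizing X v"
    and "ends_in l v" and l': "l' \<in> left_rays X" "ends_in l' v"
  shows "follower_set X l \<subseteq> follower_set X l'"
proof
  fix r assume r: "r \<in> follower_set X l"
  obtain r' where r': "join_rays l' r' \<in> X"
    using l'(1) by (auto simp: left_rays_iff follower_set_def)
  let ?s = "length v"
  let ?z = "join_rays l' r"
  have "?z \<in> X"
  proof (rule closed_under_local_approximation)
    show "closedin (sequence_topology A) X" using X by (simp add: shift_space_def)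
    fix n :: nat
    let ?u = "word_at ?z (- int (n + ?s)) n" and ?w = "word_at ?z 0 (Suc n)"
    have v_z: "word_at ?z (- int ?s) ?s = v" using l'(2) ends_in_iff by metis
    have "?u @ v = word_at ?z (- int (n + ?s)) (n + ?s)"
      using word_at_append[of ?z "- int (n + ?s)" n ?s] v_z by simp
    also have "\<dots> = word_at (join_rays l' r') (- int (n + ?s)) (n + ?s)"
      by (rule word_at_cong) (simp add: join_rays_def)
    finally have uv: "?u @ v \<in> language X" using word_at_in_language[OF r'] by metis
    have "?w = word_at (join_rays l r) 0 (Suc n)"
      by (rule word_at_cong) (simp add: join_rays_def)
    moreover have "word_at (join_rays l r) (- int ?s) ?s = v"
      using assms(3) ends_in_iff by metis
    ultimately have "v @ ?w = word_at (join_rays l r) (- int ?s) (?s + Suc n)"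
      using word_at_append[of "join_rays l r" "- int ?s" ?s "Suc n"] by simp
    then have vw: "v @ ?w \<in> language X"
      using r word_at_in_language unfolding follower_set_def by (metis mem_Collect_eq)
    have "?u @ v @ ?w \<in> language X" using v uv vw by (simp add: synchronizing_def)
    moreover have "?u @ v @ ?w = word_at ?z (- int (n + ?s)) (n + ?s + Suc n)"
      using word_at_append[of ?z "- int (n + ?s)" n ?s]
        word_at_append[of ?z "- int (n + ?s)" "n + ?s" "Suc n"] v_z
      by (simp flip: append_assoc)
    ultimately obtain y where y: "y \<in> X"
      "word_at y (- int (n + ?s)) (n + ?s + Suc n) = word_at ?z (- int (n + ?s)) (n + ?s + Suc n)"
      using language_word_atE[OF X] by (metis length_word_at)
    have "y i = ?z i" if "\<bar>i\<bar> \<le> int n" for i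
    proof -
      let ?k = "nat (i + int (n + ?s))"
      have "?k < n + ?s + Suc n" "- int (n + ?s) + int ?k = i" using that by auto
      then show ?thesis using arg_cong[OF y(2), of "\<lambda>w. w ! ?k"] by simp
    qed
    then show "\<exists>y\<in>X. \<forall>i. \<bar>i\<bar> \<le> int n \<longrightarrow> y i = ?z i" using y(1) by blast
  qed
  then show "r \<in> follower_set X l'" by (simp add: follower_set_def)
qed

lemma word_follower_set_eq:
  assumes "shift_space A X" "synchronizing X v" "l \<in> left_rays X" "ends_in l v"
  shows "word_follower_set X v = follower_set X l"
proof -
  have "follower_set X ` {l \<in> left_rays X. ends_in l v} = {follower_set X l}"
    using synchronizing_follower_set_mono[OF assms(1,2)] assms(3,4) by blast
  then show ?thesis by (simp add: word_follower_set_def)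
qed

section \<open>Paths in the Krieger graph\<close>

lemma krieger_graph_simps [simp]:
  "verts (krieger_graph X) = follower_set X ` left_rays X"
  "tail (krieger_graph X) = fst"
  "head (krieger_graph X) = (\<lambda>e. snd (snd e))"
  by (auto simp: krieger_graph_def)

lemma wf_krieger_graph: "wf_digraph (krieger_graph X)"
  by unfold_locales (auto simp: krieger_graph_def)

text \<open>The ray \<open>case_nat a r\<close> is \<open>r\<close> preceded by the letter \<open>a\<close>, so the next two lemmas say that
  the Krieger graph is deterministic.\<close>

lemma krieger_arc_head:
  assumes "shift_space A X" "e \<in> arcs (krieger_graph X)"
  shows "snd (snd e) = {r. case_nat (edge_label e) r \<in> fst e}"
  using assms follower_set_append_letter[OF assms(1)]
  by (auto simp: krieger_graph_def edge_label_def)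

lemma krieger_arc_eqI:
  assumes "shift_space A X" "e \<in> arcs (krieger_graph X)" "e' \<in> arcs (krieger_graph X)"
    and "fst e = fst e'" "edge_label e = edge_label e'"
  shows "e = e'"
  using krieger_arc_head[OF assms(1,2)] krieger_arc_head[OF assms(1,3)] assms(4,5)
  by (simp add: prod_eq_iff edge_label_def)

lemma edge_shift_krieger_iff:
  "p \<in> edge_shift (krieger_graph X) \<longleftrightarrow>
     (\<forall>i. p i \<in> arcs (krieger_graph X) \<and> snd (snd (p i)) = fst (p (i + 1)))"
  by (simp add: edge_shift_def)

text \<open>The determinism of single edges iterated along \<open>n\<close> edges: the vertex reached consists of
  the rays which, preceded by the label word read on the way, lie in the initial vertex.\<close>

lemma krieger_path_tail:
  assumes "shift_space A X" "p \<in> edge_shift (krieger_graph X)"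
  shows "fst (p (i + int n)) =
    {r. (\<lambda>k. if k < n then edge_label (p (i + int k)) else r (k - n)) \<in> fst (p i)}"
proof (induction n)
  case 0
  show ?case by simp
next
  case (Suc n)
  have arc: "p (i + int n) \<in> arcs (krieger_graph X)"
    and step: "fst (p (i + int (Suc n))) = snd (snd (p (i + int n)))"
    using assms(2) by (auto simp: edge_shift_krieger_iff algebra_simps)
  have "(if k < n then edge_label (p (i + int k))
          else case_nat (edge_label (p (i + int n))) r (k - n))
      = (if k < Suc n then edge_label (p (i + int k)) else r (k - Suc n))" for r k
  proof -
    consider "k < n" | "k = n" | d where "k = n + Suc d"
      by (metis less_imp_add_positive linorder_neqE_nat gr0_conv_Suc)
    then show ?thesis by cases simp_all
  qed
  then show ?case
    unfolding step krieger_arc_head[OF assms(1) arc] Suc.IH by simp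
qed

text \<open>Every vertex is a follower set of a left ray, so the labels along any finite stretch of a
  path can be completed on both sides to a point of the shift.\<close>

lemma krieger_path_complete:
  assumes X: "shift_space A X" and p: "p \<in> edge_shift (krieger_graph X)"
  obtains l r where "l \<in> left_rays X" "fst (p i) = follower_set X l"
    "(\<lambda>k. if k < i then l (nat (i - k - 1))
       else if k < i + int n then edge_label (p k) else r (nat (k - i - int n))) \<in> X"
proof -
  have vert: "fst (p j) \<in> follower_set X ` left_rays X" for j
    using p wf_digraph.tail_in_verts[OF wf_krieger_graph] by (fastforce simp: edge_shift_krieger_iff)
  obtain l where l: "l \<in> left_rays X" "fst (p i) = follower_set X l" using vert by blast
  obtain r where "r \<in> fst (p (i + int n))"
    using vert[of "i + int n"] left_rays_iff by (metis all_not_in_conv imageE)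
  then have "join_rays l (\<lambda>k. if k < n then edge_label (p (i + int k)) else r (k - n)) \<in> X"
    unfolding krieger_path_tail[OF X p] l(2) follower_set_def by simp
  then have "(\<lambda>k. join_rays l (\<lambda>k. if k < n then edge_label (p (i + int k)) else r (k - n))
      (k + (- i))) \<in> X"
    by (rule shift_space_shift[OF X])
  also have "(\<lambda>k. join_rays l (\<lambda>k. if k < n then edge_label (p (i + int k)) else r (k - n))
      (k + (- i))) = (\<lambda>k. if k < i then l (nat (i - k - 1))
       else if k < i + int n then edge_label (p k) else r (nat (k - i - int n)))"
    by (auto simp: fun_eq_iff join_rays_def nat_diff_distrib' nat_less_iff
        intro!: arg_cong[of _ _ r] arg_cong[of _ _ l])
  finally show ?thesis using that l by blast
qed

lemma cover_map_in_shift: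
  assumes X: "shift_space A X" and p: "p \<in> edge_shift (krieger_graph X)"
  shows "cover_map p \<in> X"
proof (rule closed_under_local_approximation)
  show "closedin (sequence_topology A) X" using X by (simp add: shift_space_def)
  fix n :: nat
  obtain l r where "(\<lambda>k. if k < - int n then l (nat (- int n - k - 1))
       else if k < - int n + int (2 * n + 1) then edge_label (p k)
       else r (nat (k - (- int n) - int (2 * n + 1)))) \<in> X"
    using krieger_path_complete[OF X p] .
  then show "\<exists>y\<in>X. \<forall>i. \<bar>i\<bar> \<le> int n \<longrightarrow> y i = cover_map p i"
    by (rule rev_bexI) (auto simp: cover_map_def)
qed

text \<open>Reading a synchronizing word leads to one and the same vertex, wherever the path starts.\<close>

lemma krieger_path_synchronizing:
  assumes X: "shift_space A X" and p: "p \<in> edge_shift (krieger_graph X)"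
    and v: "synchronizing X v" and word: "word_at (cover_map p) i (length v) = v"
  shows "fst (p (i + int (length v))) = word_follower_set X v"
proof -
  let ?n = "length v"
  obtain l where l: "l \<in> left_rays X" "fst (p i) = follower_set X l"
    using krieger_path_complete[OF X p] by blast
  \<comment> \<open>\<open>m\<close> is the left ray \<open>l v\<close>, with the letters of \<open>v\<close> taken from the labels of the path.\<close>
  define m where "m k = (if k < ?n then edge_label (p (i + int ?n - int k - 1)) else l (k - ?n))" for k
  have eq: "join_rays m r = (\<lambda>k. join_rays l
      (\<lambda>k. if k < ?n then edge_label (p (i + int k)) else r (k - ?n)) (k + int ?n))" for r
    by (auto simp: fun_eq_iff m_def join_rays_def nat_less_iff nat_diff_distrib' nat_add_distrib
        intro!: arg_cong[of _ _ r] arg_cong[of _ _ l] arg_cong[of _ _ p] arg_cong[of _ _ edge_label])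
  have F: "fst (p (i + int ?n)) = follower_set X m"
    unfolding krieger_path_tail[OF X p] l(2) follower_set_def mem_Collect_eq eq
      shift_space_shift_iff[OF X] ..
  have "fst (p (i + int ?n)) \<noteq> {}"
    using krieger_path_complete[OF X p, of "i + int ?n"] left_rays_iff by metis
  then have "m \<in> left_rays X" using F left_rays_iff by metis
  moreover have "ends_in m v"
  proof -
    have "word_at (join_rays m r) (- int ?n) ?n = word_at (cover_map p) i ?n" for r
      unfolding eq by (rule nth_equalityI) (auto simp: join_rays_def cover_map_def)
    then show ?thesis using word ends_in_iff by metis
  qed
  ultimately show ?thesis using word_follower_set_eq[OF X v] F by metis
qed

text \<open>The path in the Krieger graph traced out by a point of the shift: its vertices are the
  follower sets of the pasts of the point.\<close>

definition past_follower_set :: "(int \<Rightarrow> 'a) set \<Rightarrow> (int \<Rightarrow> 'a) \<Rightarrow> int \<Rightarrow> (nat \<Rightarrow> 'a) set" where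
  "past_follower_set X x i = follower_set X (left_part (\<lambda>k. x (k + i)))"

definition krieger_path :: "(int \<Rightarrow> 'a) set \<Rightarrow> (int \<Rightarrow> 'a) \<Rightarrow> int \<Rightarrow> 'a edge" where
  "krieger_path X x i = (past_follower_set X x i, x i, past_follower_set X x (i + 1))"

lemma cover_map_krieger_path [simp]: "cover_map (krieger_path X x) = x"
  by (simp add: cover_map_def krieger_path_def edge_label_def)

lemma krieger_path_in_edge_shift:
  assumes X: "shift_space A X" and x: "x \<in> X"
  shows "krieger_path X x \<in> edge_shift (krieger_graph X)"
proof -
  have ray: "left_part (\<lambda>k. x (k + i)) \<in> left_rays X" for i
    using shift_space_shift[OF X x] by (simp add: left_rays_def)
  have app: "left_part (\<lambda>k. x (k + (i + 1))) = append_letter (left_part (\<lambda>k. x (k + i))) (x i)" for i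
    by (auto simp: fun_eq_iff left_part_def append_letter_def algebra_simps split: nat.split)
  have "krieger_path X x i \<in> arcs (krieger_graph X)" for i
    using ray[of i] ray[of "i + 1"] unfolding krieger_graph_def krieger_path_def past_follower_set_def app
    by auto
  then show ?thesis by (auto simp: edge_shift_krieger_iff krieger_path_def)
qed

section \<open>The Fischer cover\<close>

lemma fischer_cover_graph:
  assumes "is_fischer_cover X G"
  shows "tail G = fst" "head G = (\<lambda>e. snd (snd e))"
    "arcs G = {e \<in> arcs (krieger_graph X). fst e \<in> verts G \<and> snd (snd e) \<in> verts G}"
    "wf_digraph G" "strongly_connected G"
  using assms
  by (auto simp: is_fischer_cover_def pre_digraph.sccs_def induced_subgraph_def subgraph_def
      compatible_def)

lemma fischer_cover_edge_shift:
  assumes "is_fischer_cover X G" "p \<in> edge_shift G"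
  shows "p \<in> edge_shift (krieger_graph X)"
  using assms(2) fischer_cover_graph(1-3)[OF assms(1)] by (auto simp: edge_shift_def)

lemma edge_shift_reachable:
  assumes "wf_digraph K" "q \<in> edge_shift K"
  shows "tail K (q i) \<rightarrow>\<^sup>*\<^bsub>K\<^esub> tail K (q (i + int n))"
proof (induction n)
  case 0
  show ?case using assms
    by (auto simp: edge_shift_def intro!: wf_digraph.reachable_refl wf_digraph.tail_in_verts)
next
  case (Suc n)
  have "q (i + int n) \<in> arcs K" "head K (q (i + int n)) = tail K (q (i + int (Suc n)))"
    using assms(2) by (auto simp: edge_shift_def algebra_simps)
  then have "tail K (q (i + int n)) \<rightarrow>\<^bsub>K\<^esub> tail K (q (i + int (Suc n)))"
    by (auto simp: arcs_ends_conv)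
  with Suc show ?case by (rule wf_digraph.reachable_adj_trans[OF assms(1)])
qed

text \<open>By maximality, a strong component contains every cycle through one of its vertices.\<close>

lemma scc_contains_cycle:
  assumes wf: "wf_digraph K" and G: "G \<in> pre_digraph.sccs K" and q: "q \<in> edge_shift K"
    and cycle: "tail K (q (i + int n)) = tail K (q i)" and start: "tail K (q i) \<in> verts G"
    and j: "j \<le> n"
  shows "tail K (q (i + int j)) \<in> verts G"
proof (rule ccontr)
  assume "tail K (q (i + int j)) \<notin> verts G"
  moreover have "verts G \<in> pre_digraph.sccs_verts K"
    using wf_digraph.in_sccs_vertsI_sccs[OF wf] G by blast
  moreover have "tail K (q i) \<rightarrow>\<^sup>*\<^bsub>K\<^esub> tail K (q (i + int j))"
    by (rule edge_shift_reachable[OF wf q])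
  moreover have "tail K (q (i + int j)) \<rightarrow>\<^sup>*\<^bsub>K\<^esub> tail K (q i)"
    using edge_shift_reachable[OF wf q, of "i + int j" "n - j"] j cycle
    by (simp add: of_nat_diff)
  ultimately show False using start unfolding pre_digraph.sccs_verts_def by blast
qed

text \<open>A left infinite path ending at the vertex \<open>v\<close>, read from right to left.\<close>

definition left_path :: "('v, 'e) pre_digraph \<Rightarrow> (nat \<Rightarrow> 'e) \<Rightarrow> 'v \<Rightarrow> bool" where
  "left_path G f v \<longleftrightarrow>
     (\<forall>k. f k \<in> arcs G) \<and> (\<forall>k. head G (f (Suc k)) = tail G (f k)) \<and> head G (f 0) = v"

lemma left_path_step:
  assumes "left_path G f (tail G e)" "e \<in> arcs G"
  shows "left_path G (case_nat e f) (head G e)"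
  using assms by (auto simp: left_path_def split: nat.split)

text \<open>Prolonging a left infinite path pushes its old edges \<open>m\<close> steps further into the past,
  where they stay available.\<close>

lemma left_path_reachable:
  assumes "wf_digraph G" "u \<rightarrow>\<^sup>*\<^bsub>G\<^esub> v" "left_path G f u"
  obtains g m where "left_path G g v" "\<And>k. g (m + k) = f k"
proof -
  have "\<exists>g m. left_path G g v \<and> (\<forall>k. g (m + k) = f k)"
    using assms(2)
  proof (induction rule: wf_digraph.reachable_induct[OF assms(1), consumes 1])
    case 1
    then show ?case using assms(3) by (metis add_0)
  next
    case (2 x y)
    then obtain g m where g: "left_path G g x" "\<forall>k. g (m + k) = f k" by blast
    from 2 obtain e where "e \<in> arcs G" "tail G e = x" "head G e = y" by blast
    with g(1) have "left_path G (case_nat e g) y" using left_path_step by metis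
    moreover have "\<forall>k. case_nat e g (Suc m + k) = f k" using g(2) by simp
    ultimately show ?case by blast
  qed
  then show ?thesis using that by blast
qed

lemma left_path_segment:
  assumes q: "\<And>j. j < n \<Longrightarrow> q (int j) \<in> arcs G"
    and adj: "\<And>j. head G (q j) = tail G (q (j + 1))"
    and f: "left_path G f (tail G (q 0))"
  obtains g where "left_path G g (tail G (q (int n)))" "\<And>k. k < n \<Longrightarrow> g k = q (int n - int k - 1)"
proof -
  have "\<exists>g. left_path G g (tail G (q (int n))) \<and> (\<forall>k<n. g k = q (int n - int k - 1))"
    using q
  proof (induction n)
    case 0
    then show ?case using f by auto
  next
    case (Suc n)
    then obtain g where g: "left_path G g (tail G (q (int n)))"
      "\<forall>k<n. g k = q (int n - int k - 1)" by (meson less_SucI)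
    let ?h = "case_nat (q (int n)) g"
    have "left_path G ?h (tail G (q (int (Suc n))))"
      using left_path_step[OF g(1) Suc.prems[of n]] adj[of "int n"] by (simp add: add.commute)
    moreover have "\<forall>k<Suc n. ?h k = q (int (Suc n) - int k - 1)"
      using g(2) by (auto simp: algebra_simps split: nat.split)
    ultimately show ?case by blast
  qed
  then show ?thesis using that by blast
qed

lemma left_path_of_edge_shift:
  assumes "p \<in> edge_shift G"
  shows "left_path G (\<lambda>k. p (i - int k - 1)) (tail G (p i))"
proof -
  have "head G (p (i - int (Suc k) - 1)) = tail G (p (i - int k - 1))" for k
    using assms by (auto simp: edge_shift_def)
  moreover have "head G (p (i - 1)) = tail G (p i)"
    using assms by (auto simp: edge_shift_def)
  ultimately show ?thesis using assms by (simp add: left_path_def edge_shift_def)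
qed

lemma edge_shift_splice:
  assumes p: "p \<in> edge_shift G" and f: "left_path G f (tail G (p N))"
  shows "(\<lambda>i. if i < N then f (nat (N - i - 1)) else p i) \<in> edge_shift G"
  unfolding edge_shift_def
proof (intro CollectI allI conjI)
  fix i :: int
  let ?q = "\<lambda>i. if i < N then f (nat (N - i - 1)) else p i"
  show "?q i \<in> arcs G" using p f by (simp add: edge_shift_def left_path_def)
  consider "i \<ge> N" | "i + 1 = N" | "i + 1 < N" by linarith
  then show "head G (?q i) = tail G (?q (i + 1))"
  proof cases
    case 1
    then show ?thesis using p by (simp add: edge_shift_def)
  next
    case 2
    then show ?thesis using f by (auto simp: left_path_def)
  next
    case 3
    then have "nat (N - i - 1) = Suc (nat (N - (i + 1) - 1))" by linarith
    with 3 show ?thesis using f by (simp add: left_path_def)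
  qed
qed

text \<open>The point \<open>q\<close> carries a synchronizing word before position \<open>N\<close> and agrees with \<open>p\<close> from
  there on, so its labels alone force every preimage to agree with \<open>p\<close> on \<open>[N, \<infinity>)\<close>.\<close>

lemma fischer_cover_forced_future:
  assumes X: "shift_space A X" and irr: "irreducible_shift X" and G: "is_fischer_cover X G"
    and p: "p \<in> edge_shift G"
  obtains q where "q \<in> edge_shift G"
    "\<And>q' i. q' \<in> edge_shift G \<Longrightarrow> cover_map q' = cover_map q \<Longrightarrow> N \<le> i \<Longrightarrow> q' i = p i"
proof -
  let ?K = "krieger_graph X"
  note G_simps = fischer_cover_graph[OF G]
  from G obtain v where v: "synchronizing X v" and vG: "word_follower_set X v \<in> verts G"
    and scc: "G \<in> pre_digraph.sccs ?K" by (auto simp: is_fischer_cover_def)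
  let ?s = "length v"
  have sc: "a \<rightarrow>\<^sup>*\<^bsub>G\<^esub> b" if "a \<in> verts G" "b \<in> verts G" for a b
    using that G_simps(5) by (auto simp: strongly_connected_def)
  have pN: "tail G (p N) \<in> verts G"
    using p wf_digraph.tail_in_verts[OF G_simps(4)] by (auto simp: edge_shift_def)
  \<comment> \<open>A point carrying \<open>v u v\<close> from position \<open>- length v\<close> on: its path in the Krieger graph passes
    \<open>\<omega>\<^sub>+(v)\<close> at positions \<open>0\<close> and \<open>n\<close>.\<close>
  obtain u where "v @ u @ v \<in> language X"
    using irr v unfolding irreducible_shift_def synchronizing_def by metis
  then obtain x where x: "x \<in> X" "word_at x (- int ?s) (length (v @ u @ v)) = v @ u @ v"
    using language_word_atE[OF X] by metis
  define n where "n = length u + ?s"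
  define c where "c = krieger_path X x"
  have c: "c \<in> edge_shift ?K" unfolding c_def by (rule krieger_path_in_edge_shift[OF X x(1)])
  have "v @ u @ v = word_at x (- int ?s) ?s @ word_at x 0 (length u) @ word_at x (int (length u)) ?s"
    using x(2) word_at_append[of x "- int ?s" ?s n]
      word_at_append[of x 0 "length u" ?s] by (simp add: n_def add.assoc)
  then have xv: "word_at x (- int ?s) ?s = v" "word_at x (int (length u)) ?s = v"
    by (simp_all add: append_eq_append_conv)
  have c0: "fst (c 0) = word_follower_set X v"
    using krieger_path_synchronizing[OF X c v, of "- int ?s"] xv(1) by (simp add: c_def)
  have cn: "fst (c (int n)) = word_follower_set X v"
    using krieger_path_synchronizing[OF X c v, of "int (length u)"] xv(2)
    by (simp add: c_def n_def)
  have cverts: "fst (c (int j)) \<in> verts G" if "j \<le> n" for j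
    using scc_contains_cycle[OF wf_krieger_graph scc c, of 0 n j] c0 cn vG that by simp
  have carcs: "c (int j) \<in> arcs G" if "j < n" for j
    using cverts[of j] cverts[of "Suc j"] that c
    unfolding G_simps(3) edge_shift_krieger_iff by (simp add: add.commute)
  have cadj: "head G (c j) = tail G (c (j + 1))" for j
    using c unfolding G_simps edge_shift_krieger_iff by simp
  \<comment> \<open>The past of \<open>p\<close> is prolonged by a walk to \<open>\<omega>\<^sub>+(v)\<close> (\<open>f1\<close>), by the cycle (\<open>f2\<close>), and by a walk
    of length \<open>m\<close> back to the vertex of \<open>p\<close> at position \<open>N\<close> (\<open>f\<close>).\<close>
  obtain f1 where f1: "left_path G f1 (tail G (c 0))"
    using left_path_reachable[OF G_simps(4) sc[OF pN vG] left_path_of_edge_shift[OF p]] c0 G_simps(1)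
    by metis
  obtain f2 where f2: "left_path G f2 (tail G (c (int n)))"
    "\<And>k. k < n \<Longrightarrow> f2 k = c (int n - int k - 1)"
    using left_path_segment[of n c G, OF carcs cadj f1] by metis
  have "tail G (c (int n)) \<rightarrow>\<^sup>*\<^bsub>G\<^esub> tail G (p N)"
    using sc[OF vG pN] cn G_simps(1) by simp
  then obtain f m where f: "left_path G f (tail G (p N))" "\<And>k. f (m + k) = f2 k"
    using left_path_reachable[OF G_simps(4) _ f2(1)] by metis
  define q where "q = (\<lambda>i. if i < N then f (nat (N - i - 1)) else p i)"
  have q: "q \<in> edge_shift G" unfolding q_def by (rule edge_shift_splice[OF p f(1)])
  \<comment> \<open>The cycle, and with it the final copy of \<open>v\<close>, ends at position \<open>M\<close> of \<open>q\<close>.\<close>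
  define M where "M = N - int m"
  have "q (M - int ?s + int k) = c (int (length u) + int k)" if "k < ?s" for k
  proof -
    have "q (M - int ?s + int k) = f (m + (?s - 1 - k))"
      using that by (auto simp: q_def M_def intro!: arg_cong[of _ _ f])
    also have "\<dots> = c (int (length u) + int k)"
      using that f2(2)[of "?s - 1 - k"] unfolding f(2)
      by (auto simp: n_def of_nat_diff intro!: arg_cong[of _ _ c])
    finally show ?thesis .
  qed
  then have "word_at (cover_map q) (M - int ?s) ?s = word_at (cover_map c) (int (length u)) ?s"
    by (intro nth_equalityI) (auto simp: cover_map_def)
  then have qv: "word_at (cover_map q) (M - int ?s) ?s = v" using xv(2) by (simp add: c_def)
  have sync: "fst (q' M) = word_follower_set X v"
    if "q' \<in> edge_shift G" "cover_map q' = cover_map q" for q'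
    using krieger_path_synchronizing[OF X fischer_cover_edge_shift[OF G that(1)] v, of "M - int ?s"]
      that(2) qv by simp
  have "q' i = p i" if q': "q' \<in> edge_shift G" "cover_map q' = cover_map q" and "N \<le> i" for q' i
  proof -
    note qK = fischer_cover_edge_shift[OF G q] and q'K = fischer_cover_edge_shift[OF G q'(1)]
    have lab: "edge_label (q' j) = edge_label (q j)" for j
      using fun_cong[OF q'(2), of j] by (simp add: cover_map_def)
    have eqI: "q' j = q j" if "fst (q' j) = fst (q j)" for j
      using krieger_arc_eqI[OF X _ _ that lab] qK q'K by (simp add: edge_shift_krieger_iff)
    have "q' (M + int k) = q (M + int k)" for k
    proof (induction k)
      case 0
      show ?case using eqI[of M] sync[OF q'] sync[OF q refl] by simp
    next
      case (Suc k)
      have "fst (q' (M + int k + 1)) = fst (q (M + int k + 1))"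
        using Suc qK q'K unfolding edge_shift_krieger_iff by metis
      then show ?case using eqI[of "M + int k + 1"] by (simp add: algebra_simps)
    qed
    from this[of "nat (i - M)"] show ?thesis using \<open>N \<le> i\<close> by (simp add: M_def q_def)
  qed
  then show ?thesis using that q by blast
qed

section \<open>Irreducibility of the cover map\<close>

lemma topspace_edge_shift_topology: "topspace (edge_shift_topology G) = edge_shift G"
  by (auto simp: edge_shift_topology_def sequence_topology_def edge_shift_def)

lemma continuous_cover_map:
  assumes X: "shift_space A X" and G: "is_fischer_cover X G"
  shows "continuous_map (edge_shift_topology G) (subtopology (sequence_topology A) X) cover_map"
proof -
  have sub: "X \<subseteq> (UNIV \<rightarrow>\<^sub>E A)"
    using X closedin_subset unfolding shift_space_def sequence_topology_def by fastforce
  have img: "cover_map p \<in> X" if "p \<in> edge_shift G" for p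
    using cover_map_in_shift[OF X fischer_cover_edge_shift[OF G that]] .
  show ?thesis
    unfolding continuous_map_in_subtopology topspace_edge_shift_topology
  proof
    show "cover_map \<in> edge_shift G \<rightarrow> X" using img by blast
    have "continuous_map (edge_shift_topology G) (discrete_topology A) (\<lambda>p. cover_map p i)" for i
    proof -
      have proj: "continuous_map (edge_shift_topology G) (discrete_topology (arcs G)) (\<lambda>p. p i)"
        unfolding edge_shift_topology_def sequence_topology_def
        by (intro continuous_map_from_subtopology continuous_map_product_projection) simp
      show ?thesis
        unfolding continuous_map_def
      proof (intro conjI allI impI)
        show "(\<lambda>p. cover_map p i) \<in> topspace (edge_shift_topology G) \<rightarrow> topspace (discrete_topology A)"
          using img sub by (auto simp: topspace_edge_shift_topology)
        fix U :: "'a set"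
        have "{p \<in> topspace (edge_shift_topology G). p i \<in> {e \<in> arcs G. edge_label e \<in> U}}
            = {p \<in> topspace (edge_shift_topology G). cover_map p i \<in> U}"
          by (auto simp: topspace_edge_shift_topology edge_shift_def cover_map_def)
        moreover have "openin (edge_shift_topology G)
            {p \<in> topspace (edge_shift_topology G). p i \<in> {e \<in> arcs G. edge_label e \<in> U}}"
          by (rule openin_continuous_map_preimage[OF proj]) auto
        ultimately show "openin (edge_shift_topology G)
            {p \<in> topspace (edge_shift_topology G). cover_map p i \<in> U}" by simp
      qed
    qed
    then show "continuous_map (edge_shift_topology G) (sequence_topology A) cover_map"
      unfolding sequence_topology_def continuous_map_componentwise_UNIV by blast
  qed
qed

theorem theorem3p8:
  fixes A :: "'a set"
    and X :: "(int \<Rightarrow> 'a) set"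
    and G :: "((nat \<Rightarrow> 'a) set, 'a edge) pre_digraph"
  assumes "synchronized_system A X"
    and "is_fischer_cover X G"
  shows "irreducible_map (edge_shift_topology G) (subtopology (sequence_topology A) X) cover_map"
  unfolding irreducible_map_def topspace_edge_shift_topology
proof (intro conjI allI impI)
  have X: "shift_space A X" "irreducible_shift X"
    using assms(1) by (auto simp: synchronized_system_def)
  show "continuous_map (edge_shift_topology G) (subtopology (sequence_topology A) X) cover_map"
    by (rule continuous_cover_map[OF X(1) assms(2)])
  fix C assume C: "closedin (edge_shift_topology G) C \<and> cover_map ` C = cover_map ` edge_shift G"
  then obtain D where D: "closedin (sequence_topology (arcs G)) D" "C = D \<inter> edge_shift G"
    by (auto simp: edge_shift_topology_def closedin_subtopology)
  have "p \<in> D" if p: "p \<in> edge_shift G" for p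
  proof (rule closed_under_local_approximation[OF D(1)])
    fix n :: nat
    obtain q where q: "q \<in> edge_shift G"
      "\<And>q' i. q' \<in> edge_shift G \<Longrightarrow> cover_map q' = cover_map q \<Longrightarrow> - int n \<le> i \<Longrightarrow> q' i = p i"
      using fischer_cover_forced_future[OF X assms(2) p] by metis
    then obtain q' where "q' \<in> C" "cover_map q' = cover_map q" using C by (metis imageE imageI)
    then show "\<exists>y\<in>D. \<forall>i. \<bar>i\<bar> \<le> int n \<longrightarrow> y i = p i" using q(2) D(2) by force
  qed
  then show "C = edge_shift G" using D(2) by blast
qed

end
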